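(* Let $S$ be an inverse semigroup with zero such that for every $s\in S$ the set $\mathcal{J}_s=\{e\in E(S): e\leqslant s\}$ has a finite cover. Consider the following statements: (i) For all $s\in S$ the set $\mathcal{W}_s$ of idempotents weakly fixed by $s$ has a finite cover. (ii) $\mathrm{Iso}(\mathcal{G}_{\mathrm{tight}}(S))^\circ$ is closed in $\mathcal{G}_{\mathrm{tight}}(S)$. (iii) $\mathrm{Iso}(\mathcal{G}_{\mathrm{tight}}(S))^\circ=\mathcal{G}_{\mathrm{tight}}(S^{\mathrm{Iso}})$. (iv) Every tight filter in $E(S)$ is an ultrafilter. Then (i) $\Rightarrow$ (ii), (i) $\Rightarrow$ (iii), (iv) $\Rightarrow$ (iii), and (iv) together with (ii) $\Rightarrow$ (i).
   Context: An inverse semigroup is a semigroup $S$ in which every $s$ has a unique $s^*$ with $ss^*s=s$, $s^*ss^*=s^*$; $E(S)$ is its set of idempotents. $s\leqslant t$ iff $s=te$ for some $e\in E(S)$. For $C\subseteq D\subseteq E(S)$, $C$ is a cover of $D$ if for each nonzero $d\in D$ there is $c\in C$ with $dc\neq0$. A filter is a nonempty proper subset of $E(S)$ that is upwards closed and closed under products; filters carry the topology from $\{0,1\}^{E(S)}$. An ultrafilter is a maximal filter. $\widehat E_{\mathrm{tight}}(S)$, the space of tight filters, is the closure of the set of ultrafilters in the space of filters; $D_e=\{\xi\in\widehat E_{\mathrm{tight}}(S): e\in\xi\}$; $\theta_s:D_{s^*s}\to D_{ss^*}$, $\theta_s(\xi)=\{f\in E(S): f\geqslant ses^*\text{ for some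 }e\in\xi\}$. The tight groupoid is $\mathcal{G}_{\mathrm{tight}}(S)=\{[s,\xi]: s\in S, \xi\in D_{s^*s}\}$, where $[s,\xi]=[t,\eta]$ iff $\xi=\eta$ and $se=te$ for some $e\in\xi$, with $d[s,\xi]=\xi$, $r[s,\xi]=\theta_s(\xi)$, $[s,\xi]^{-1}=[s^*,\theta_s(\xi)]$, $[s,\theta_t(\xi)][t,\xi]=[st,\xi]$, and topology with basis $\Theta(s,U)=\{[s,\xi]:\xi\in U\}$, $U\subseteq D_{s^*s}$ compact open. It is étale, and Hausdorff iff every $\mathcal{J}_s$ has a finite cover. $\mathrm{Iso}(\mathcal{G})=\{\gamma\in\mathcal{G}: d(\gamma)=r(\gamma)\}$ and $^\circ$ denotes topological interior. An idempotent $e\leqslant s^*s$ is weakly fixed by $s$ if $sfs^*f\neq0$ for all $f\in E(S)$ with $0<f\leqslant e$; $\mathcal{W}_s$ is the set of such $e$. $S^{\mathrm{Iso}}=\{s\in S: s^*s\text{ is weakly fixed by }s\}$, an inverse subsemigroup containing $E(S)$; $\mathcal{G}_{\mathrm{tight}}(S^{\mathrm{Iso}})$ is identified with the open subgroupoid $\{[s,\xi]: s\in S^{\mathrm{Iso}},\xi\in D_{s^*s}\}$ of $\mathcal{G}_{\mathrm{tight}}(S)$. *)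

theory Defs
  imports "HOL-Analysis.Analysis"
begin

section \<open>Inverse semigroups with zero\<close>

class inverse_semigroup = semigroup_mult +
  assumes ex1_inverse: "\<exists>!t. s * t * s = s \<and> t * s * t = t"

class inverse_semigroup_zero = inverse_semigroup + mult_zero

definition sinv :: "'a::inverse_semigroup \<Rightarrow> 'a"  ("(_\<^sup>\<star>)" [1000] 999)
  where "s\<^sup>\<star> = (THE t. s * t * s = s \<and> t * s * t = t)"

definition idems :: "'a::inverse_semigroup set"
  where "idems = {e. e * e = e}"

definition nat_le :: "'a::inverse_semigroup \<Rightarrow> 'a \<Rightarrow> bool"  (infix "\<preceq>" 50)
  where "s \<preceq> t \<longleftrightarrow> (\<exists>e\<in>idems. s = t * e)"

definition is_cover :: "'a::inverse_semigroup_zero set \<Rightarrow> 'a set \<Rightarrow> bool"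
  where "is_cover C D \<longleftrightarrow> C \<subseteq> D \<and> (\<forall>d\<in>D. d \<noteq> 0 \<longrightarrow> (\<exists>c\<in>C. d * c \<noteq> 0))"

definition has_finite_cover :: "'a::inverse_semigroup_zero set \<Rightarrow> bool"
  where "has_finite_cover D \<longleftrightarrow> (\<exists>C. finite C \<and> is_cover C D)"

definition J_set :: "'a::inverse_semigroup_zero \<Rightarrow> 'a set"
  where "J_set s = {e \<in> idems. e \<preceq> s}"

text \<open>Since 0 lies below every idempotent, \<open>0 < f \<le> e\<close> means \<open>f \<noteq> 0\<close> and \<open>f \<preceq> e\<close>.
  In particular 0 itself is (vacuously) weakly fixed by every element.\<close>

definition weakly_fixed :: "'a::inverse_semigroup_zero \<Rightarrow> 'a \<Rightarrow> bool"
  where "weakly_fixed s e \<longleftrightarrow> e \<in> idems \<and> e \<preceq> s\<^sup>\<star> * s \<and>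
    (\<forall>f\<in>idems. f \<noteq> 0 \<and> f \<preceq> e \<longrightarrow> s * f * s\<^sup>\<star> * f \<noteq> 0)"

definition W_set :: "'a::inverse_semigroup_zero \<Rightarrow> 'a set"
  where "W_set s = {e. weakly_fixed s e}"

definition S_Iso :: "'a::inverse_semigroup_zero set"
  where "S_Iso = {s. weakly_fixed s (s\<^sup>\<star> * s)}"


section \<open>Filters\<close>

definition filters :: "'a::inverse_semigroup_zero set set"
  where "filters = {\<xi>. \<xi> \<noteq> {} \<and> \<xi> \<subset> idems \<and>
    (\<forall>e\<in>\<xi>. \<forall>f\<in>idems. e \<preceq> f \<longrightarrow> f \<in> \<xi>) \<and> (\<forall>e\<in>\<xi>. \<forall>f\<in>\<xi>. e * f \<in> \<xi>)}"

definition ultrafilters :: "'a::inverse_semigroup_zero set set"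
  where "ultrafilters = {\<xi> \<in> filters. \<forall>\<eta>\<in>filters. \<xi> \<subseteq> \<eta> \<longrightarrow> \<eta> = \<xi>}"

text \<open>The subspace topology from \<open>{0,1}\<^sup>E\<close>, a filter being identified with its
  characteristic function on the set of idempotents.\<close>

definition filter_topology :: "'a::inverse_semigroup_zero set topology"
  where "filter_topology = pullback_topology filters (\<lambda>\<xi>. restrict (\<lambda>e. e \<in> \<xi>) idems)
    (product_topology (\<lambda>_. discrete_topology (UNIV :: bool set)) idems)"

definition tight_filters :: "'a::inverse_semigroup_zero set set"
  where "tight_filters = filter_topology closure_of ultrafilters"

definition tight_topology :: "'a::inverse_semigroup_zero set topology"
  where "tight_topology = subtopology filter_topology tight_filters"

definition D_set :: "'a::inverse_semigroup_zero \<Rightarrow> 'a set set"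
  where "D_set e = {\<xi> \<in> tight_filters. e \<in> \<xi>}"

definition theta :: "'a::inverse_semigroup_zero \<Rightarrow> 'a set \<Rightarrow> 'a set"
  where "theta s \<xi> = {f \<in> idems. \<exists>e\<in>\<xi>. s * e * s\<^sup>\<star> \<preceq> f}"


section \<open>The tight groupoid\<close>

text \<open>A germ \<open>[s,\<xi>]\<close> is an equivalence class of pairs.\<close>

type_synonym 'a germ = "('a \<times> 'a set) set"

definition germ_pairs :: "('a::inverse_semigroup_zero \<times> 'a set) set"
  where "germ_pairs = {(s, \<xi>). \<xi> \<in> D_set (s\<^sup>\<star> * s)}"

definition germ_rel :: "(('a::inverse_semigroup_zero \<times> 'a set) \<times> ('a \<times> 'a set)) set"
  where "germ_rel = {((s, \<xi>), (t, \<eta>)). (s, \<xi>) \<in> germ_pairs \<and> (t, \<eta>) \<in> germ_pairs \<and>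
    \<xi> = \<eta> \<and> (\<exists>e\<in>\<xi>. s * e = t * e)}"

definition germ :: "'a::inverse_semigroup_zero \<Rightarrow> 'a set \<Rightarrow> 'a germ"
  where "germ s \<xi> = germ_rel `` {(s, \<xi>)}"

definition tight_groupoid :: "'a::inverse_semigroup_zero germ set"
  where "tight_groupoid = germ_pairs // germ_rel"

text \<open>Domain and range are read off from representatives; see \<open>germ_dom_germ\<close> and
  \<open>germ_ran_germ\<close> below for independence of the choice.\<close>

definition germ_dom :: "'a::inverse_semigroup_zero germ \<Rightarrow> 'a set"
  where "germ_dom \<gamma> = the_elem (snd ` \<gamma>)"

definition germ_ran :: "'a::inverse_semigroup_zero germ \<Rightarrow> 'a set"
  where "germ_ran \<gamma> = the_elem ((\<lambda>(s, \<xi>). theta s \<xi>) ` \<gamma>)"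

definition Theta :: "'a::inverse_semigroup_zero \<Rightarrow> 'a set set \<Rightarrow> 'a germ set"
  where "Theta s U = germ s ` U"

definition tight_groupoid_topology :: "'a::inverse_semigroup_zero germ topology"
  where "tight_groupoid_topology = topology_generated_by
    {Theta s U | s U. U \<subseteq> D_set (s\<^sup>\<star> * s) \<and> openin tight_topology U \<and> compactin tight_topology U}"

definition Iso :: "'a::inverse_semigroup_zero germ set"
  where "Iso = {\<gamma> \<in> tight_groupoid. germ_dom \<gamma> = germ_ran \<gamma>}"

definition Iso_interior :: "'a::inverse_semigroup_zero germ set"
  where "Iso_interior = tight_groupoid_topology interior_of Iso"

text \<open>The tight groupoid of the inverse subsemigroup \<open>S_Iso\<close>, which has the same idempotents
  (hence the same tight filters), under its canonical identification with an open subgroupoid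
  of the tight groupoid of the whole semigroup.\<close>

definition tight_groupoid_S_Iso :: "'a::inverse_semigroup_zero germ set"
  where "tight_groupoid_S_Iso = {germ s \<xi> | s \<xi>. s \<in> S_Iso \<and> \<xi> \<in> D_set (s\<^sup>\<star> * s)}"


section \<open>Domain and range do not depend on representatives\<close>

lemma sinv_eqs: "s * s\<^sup>\<star> * s = s" "s\<^sup>\<star> * s * s\<^sup>\<star> = s\<^sup>\<star>"
  using theI'[OF ex1_inverse[of s]] unfolding sinv_def by blast+

lemma sinv_unique: "s * t * s = s \<Longrightarrow> t * s * t = t \<Longrightarrow> s\<^sup>\<star> = t"
  using ex1_inverse[of s] sinv_eqs[of s] by blast

lemma sinv_idem: "e \<in> idems \<Longrightarrow> e\<^sup>\<star> = e"
  by (rule sinv_unique) (auto simp: idems_def)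

lemma idems_mult:
  assumes "e \<in> idems" "f \<in> idems"
  shows "e * f \<in> idems"
proof -
  have ee: "e * e = e" "e * (e * z) = e * z" and ff: "f * f = f" "f * (f * z) = f * z" for z
    using assms by (auto simp: idems_def simp flip: mult.assoc)
  define x where "x = (e * f)\<^sup>\<star>"
  have x1: "e * (f * (x * (e * f))) = e * f" and x2: "x * (e * (f * x)) = x"
    using sinv_eqs[of "e * f"] by (simp_all add: x_def mult.assoc)
  have x2': "x * (e * (f * (x * z))) = x * z" for z
    using x2 by (metis mult.assoc)
  have x: "x = f * x * e"
    unfolding x_def by (rule sinv_unique) (simp_all flip: x_def add: mult.assoc ee ff x1 x2')
  have "x * x = (f * x * e) * (f * x * e)"
    using x by simp
  also have "\<dots> = f * x * e"
    by (simp add: mult.assoc x2')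
  finally have "x * x = x"
    using x by simp
  moreover have "x\<^sup>\<star> = e * f"
    by (rule sinv_unique) (simp_all add: mult.assoc x1 x2)
  ultimately show ?thesis
    using sinv_idem[of x] by (simp add: idems_def)
qed

lemma idems_commute:
  assumes "e \<in> idems" "f \<in> idems"
  shows "e * f = f * e"
proof -
  have ee: "e * (e * z) = e * z" and ff: "f * (f * z) = f * z" for z
    using assms by (auto simp: idems_def simp flip: mult.assoc)
  have "e * (f * (e * f)) = e * f" "f * (e * (f * e)) = f * e"
    using idems_mult[OF assms] idems_mult[OF assms(2,1)] by (auto simp: idems_def mult.assoc)
  then have "(e * f)\<^sup>\<star> = f * e"
    by (intro sinv_unique) (simp_all add: mult.assoc ee ff)
  then show ?thesis
    using sinv_idem[OF idems_mult[OF assms]] by simp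
qed

lemma sinv_mult_idems: "s\<^sup>\<star> * s \<in> idems"
  unfolding idems_def by (metis (mono_tags) mem_Collect_eq mult.assoc sinv_eqs(1))

lemma sinv_mult_idem:
  assumes "e \<in> idems"
  shows "(s * e)\<^sup>\<star> = e * s\<^sup>\<star>"
proof (rule sinv_unique)
  have c: "e * (s\<^sup>\<star> * (s * z)) = s\<^sup>\<star> * (s * (e * z))" for z
    using idems_commute[OF assms sinv_mult_idems[of s]] by (metis mult.assoc)
  have ee: "e * e = e" "e * (e * z) = e * z" for z
    using assms by (auto simp: idems_def simp flip: mult.assoc)
  have ss: "s * (s\<^sup>\<star> * (s * z)) = s * z" "s\<^sup>\<star> * (s * (s\<^sup>\<star> * z)) = s\<^sup>\<star> * z" "s\<^sup>\<star> * (s * s\<^sup>\<star>) = s\<^sup>\<star>" for z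
    using sinv_eqs[of s] by (simp_all flip: mult.assoc)
  show "s * e * (e * s\<^sup>\<star>) * (s * e) = s * e"
    by (simp add: mult.assoc ee c ss)
  have "e * s\<^sup>\<star> * (s * e) * (e * s\<^sup>\<star>) = e * (s\<^sup>\<star> * (s * (e * s\<^sup>\<star>)))"
    by (simp add: mult.assoc ee)
  also have "\<dots> = e * (e * (s\<^sup>\<star> * (s * s\<^sup>\<star>)))"
    by (simp only: c)
  also have "\<dots> = e * s\<^sup>\<star>"
    by (simp add: ee ss)
  finally show "e * s\<^sup>\<star> * (s * e) * (e * s\<^sup>\<star>) = e * s\<^sup>\<star>" .
qed

lemma conj_le:
  assumes "e \<in> idems" "g \<in> idems"
  shows "s * (g * e) * s\<^sup>\<star> \<preceq> s * g * s\<^sup>\<star>"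
proof -
  have c: "e * (s\<^sup>\<star> * (s * z)) = s\<^sup>\<star> * (s * (e * z))" for z
    using idems_commute[OF assms(1) sinv_mult_idems[of s]] by (metis mult.assoc)
  have ee: "e * (e * z) = e * z" for z
    using assms by (auto simp: idems_def simp flip: mult.assoc)
  have ss: "s\<^sup>\<star> * (s * (s\<^sup>\<star> * z)) = s\<^sup>\<star> * z" "s\<^sup>\<star> * (s * s\<^sup>\<star>) = s\<^sup>\<star>" for z
    using sinv_eqs[of s] by (simp_all flip: mult.assoc)
  have r: "s\<^sup>\<star> * (s * (e * s\<^sup>\<star>)) = e * s\<^sup>\<star>"
    using c[of "s\<^sup>\<star>"] ss by simp
  have "s * e * s\<^sup>\<star> \<in> idems"
    by (simp add: idems_def mult.assoc r ee)
  moreover have "s * (g * e) * s\<^sup>\<star> = s * g * s\<^sup>\<star> * (s * e * s\<^sup>\<star>)"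
    by (simp add: mult.assoc r)
  ultimately show ?thesis
    unfolding nat_le_def by blast
qed

lemma nat_le_trans: "a \<preceq> b \<Longrightarrow> b \<preceq> c \<Longrightarrow> a \<preceq> c"
  unfolding nat_le_def using idems_mult by (metis mult.assoc)

lemma theta_mono_germ:
  assumes "\<xi> \<in> filters" "e \<in> \<xi>" "s * e = t * e"
  shows "theta s \<xi> \<subseteq> theta t \<xi>"
proof
  fix f assume "f \<in> theta s \<xi>"
  then obtain g where f: "f \<in> idems" "g \<in> \<xi>" "s * g * s\<^sup>\<star> \<preceq> f"
    by (auto simp: theta_def)
  have E: "e \<in> idems" "g \<in> idems" "g * e \<in> \<xi>"
    using assms f by (auto simp: filters_def)
  have conj: "u * (g * e) * u\<^sup>\<star> = (u * e) * g * (u * e)\<^sup>\<star>" for u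
  proof -
    have "u * e * g * (e * u\<^sup>\<star>) = u * (e * g) * e * u\<^sup>\<star>"
      by (simp add: mult.assoc)
    also have "\<dots> = u * (g * e * e) * u\<^sup>\<star>"
      by (simp add: idems_commute[OF E(1,2)] mult.assoc)
    also have "g * e * e = g * e"
      using E(1) by (simp add: idems_def mult.assoc)
    finally show ?thesis
      by (simp add: sinv_mult_idem[OF E(1)])
  qed
  have "t * (g * e) * t\<^sup>\<star> = s * (g * e) * s\<^sup>\<star>"
    by (simp add: conj assms(3))
  also have "\<dots> \<preceq> s * g * s\<^sup>\<star>"
    by (rule conj_le[OF E(1,2)])
  finally have "t * (g * e) * t\<^sup>\<star> \<preceq> f"
    using f(3) nat_le_trans by blast
  then show "f \<in> theta t \<xi>"
    using f(1) E(3) by (auto simp: theta_def)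
qed

lemma tight_filters_subset: "tight_filters \<subseteq> filters"
  using closure_of_subset_topspace[of filter_topology ultrafilters]
  by (auto simp: tight_filters_def filter_topology_def topspace_pullback_topology)

lemma equiv_germ_rel:
  "equiv (germ_pairs :: ('a::inverse_semigroup_zero \<times> 'a set) set) germ_rel" (is "equiv ?A ?R")
proof (rule equivI)
  show "?R \<subseteq> ?A \<times> ?A"
    by (auto simp: germ_rel_def)
  show "sym ?R"
  proof (rule symI, clarify)
    fix s t :: 'a and \<xi> \<eta>
    assume r: "((s, \<xi>), (t, \<eta>)) \<in> germ_rel"
    then obtain e where "e \<in> \<xi>" "s * e = t * e"
      by (auto simp: germ_rel_def)
    then have "\<exists>e\<in>\<xi>. t * e = s * e"
      by (intro bexI[of _ e]) simp_all
    then show "((t, \<eta>), (s, \<xi>)) \<in> germ_rel"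
      using r unfolding germ_rel_def by blast
  qed
  show "refl_on ?A ?R"
    by (auto simp: germ_rel_def refl_on_def germ_pairs_def D_set_def)
  show "trans ?R"
  proof (rule transI, clarify)
    fix s t u :: 'a and \<xi> \<eta> \<zeta>
    assume r: "((s, \<xi>), (t, \<eta>)) \<in> germ_rel" "((t, \<eta>), (u, \<zeta>)) \<in> germ_rel"
    then obtain e f where ef: "e \<in> \<xi>" "f \<in> \<xi>" "s * e = t * e" "t * f = u * f"
      by (auto simp: germ_rel_def)
    have \<xi>: "\<xi> \<in> filters"
      using r tight_filters_subset by (auto simp: germ_rel_def germ_pairs_def D_set_def)
    then have c: "e * f = f * e"
      using ef by (intro idems_commute) (auto simp: filters_def)
    have "s * (e * f) = t * (e * f)"
      by (metis ef(3) mult.assoc)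
    also have "\<dots> = u * (e * f)"
      by (metis ef(4) c mult.assoc)
    finally have "\<exists>g\<in>\<xi>. s * g = u * g"
      using \<xi> ef by (intro bexI[of _ "e * f"]) (auto simp: filters_def)
    then show "((s, \<xi>), (u, \<zeta>)) \<in> germ_rel"
      using r by (auto simp: germ_rel_def)
  qed
qed

lemma germ_eq_iff:
  assumes "\<xi> \<in> D_set (s\<^sup>\<star> * s)" "\<eta> \<in> D_set (t\<^sup>\<star> * t)"
  shows "germ s \<xi> = germ t \<eta> \<longleftrightarrow> \<xi> = \<eta> \<and> (\<exists>e\<in>\<xi>. s * e = t * e)"
proof -
  have p: "(s, \<xi>) \<in> germ_pairs" "(t, \<eta>) \<in> germ_pairs"
    using assms by (simp_all add: germ_pairs_def)
  show ?thesis
    unfolding germ_def eq_equiv_class_iff[OF equiv_germ_rel p] by (simp add: germ_rel_def p)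
qed

lemma tight_groupoid_eq: "tight_groupoid = {germ s \<xi> | s \<xi>. \<xi> \<in> D_set (s\<^sup>\<star> * s)}"
  by (auto simp: tight_groupoid_def germ_def quotient_def germ_pairs_def)

lemma germ_dom_germ:
  assumes "\<xi> \<in> D_set (s\<^sup>\<star> * s)"
  shows "germ_dom (germ s \<xi>) = \<xi>"
proof -
  have "(s, \<xi>) \<in> germ s \<xi>"
    using equiv_class_self[OF equiv_germ_rel] assms by (auto simp: germ_def germ_pairs_def)
  then have "snd ` germ s \<xi> = {\<xi>}"
    by (force simp: germ_def germ_rel_def)
  then show ?thesis
    by (simp add: germ_dom_def)
qed

lemma germ_ran_germ:
  assumes "\<xi> \<in> D_set (s\<^sup>\<star> * s)"
  shows "germ_ran (germ s \<xi>) = theta s \<xi>"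
proof -
  have \<xi>: "\<xi> \<in> filters"
    using assms tight_filters_subset by (auto simp: D_set_def)
  have 1: "(s, \<xi>) \<in> germ s \<xi>"
    using equiv_class_self[OF equiv_germ_rel] assms by (auto simp: germ_def germ_pairs_def)
  have 2: "theta t \<eta> = theta s \<xi>" if t: "(t, \<eta>) \<in> germ s \<xi>" for t \<eta>
  proof -
    obtain e where e: "\<eta> = \<xi>" "e \<in> \<xi>" "s * e = t * e"
      using t by (auto simp: germ_def germ_rel_def)
    show ?thesis
      unfolding e(1)
      using theta_mono_germ[OF \<xi> e(2) e(3)] theta_mono_germ[OF \<xi> e(2) e(3)[symmetric]]
      by (rule equalityI[rotated])
  qed
  have "(\<lambda>(s, \<xi>). theta s \<xi>) ` germ s \<xi> = {theta s \<xi>}"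
  proof (intro equalityI subsetI)
    show "x \<in> {theta s \<xi>}" if "x \<in> (\<lambda>(s, \<xi>). theta s \<xi>) ` germ s \<xi>" for x
      using that 2 by blast
    show "x \<in> (\<lambda>(s, \<xi>). theta s \<xi>) ` germ s \<xi>" if "x \<in> {theta s \<xi>}" for x
      using that 1 by (intro image_eqI[of _ _ "(s, \<xi>)"]) simp_all
  qed
  then show ?thesis
    by (simp add: germ_ran_def)
qed

end

theory Submission
  imports Defs
begin

text \<open>An idempotent \<open>e \<le> s\<^sup>\<star>s\<close> is weakly fixed by \<open>s\<close> iff \<open>\<theta>\<^sub>s\<close> fixes every tight filter
  containing \<open>e\<close>. For an ultrafilter \<open>\<eta>\<close> the sets \<open>D\<^sub>e\<close> with \<open>e \<in> \<eta>\<close> form a neighbourhood base,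
  so \<open>[s, \<eta>]\<close> is interior to the isotropy iff \<open>\<eta>\<close> contains a weakly fixed idempotent of \<open>s\<close>.
  A finite cover of \<open>\<W>\<^sub>s\<close> extends this to tight filters by density of the ultrafilters, since
  avoiding the cover is an open condition; it then describes the interior inside the bisection of
  \<open>s\<close> by a clopen set of filters. Conversely, if the interior is closed and all tight filters are
  ultrafilters, its trace on the compact set \<open>D\<^bsub>s\<^sup>\<star>s\<^esub>\<close> is compact and covered by the \<open>D\<^sub>e\<close> with
  \<open>e \<in> \<W>\<^sub>s\<close>, and a finite subcover gives a finite cover of \<open>\<W>\<^sub>s\<close>.\<close>

section \<open>Idempotents\<close>

lemma zero_in_idems: "(0::'a::inverse_semigroup_zero) \<in> idems"
  by (simp add: idems_def)

lemma nat_le_idem_iff: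
  assumes "e \<in> idems" "f \<in> idems"
  shows "e \<preceq> f \<longleftrightarrow> f * e = e"
proof
  assume "e \<preceq> f"
  then obtain g where "e = f * g"
    by (auto simp: nat_le_def)
  moreover have "f * (f * g) = f * g"
    using assms(2) by (simp add: idems_def flip: mult.assoc)
  ultimately show "f * e = e"
    by simp
next
  assume "f * e = e"
  then show "e \<preceq> f"
    unfolding nat_le_def using assms(1) by (intro bexI[of _ e]) simp_all
qed

lemma idem_mult_nat_le:
  assumes "e \<in> idems" "f \<in> idems"
  shows "e * f \<preceq> e" "e * f \<preceq> f"
proof -
  show "e * f \<preceq> e"
    unfolding nat_le_def using assms(2) by (intro bexI[of _ f]) simp_all
  show "e * f \<preceq> f"
    unfolding nat_le_def using assms(1) idems_commute[OF assms] by (intro bexI[of _ e]) simp_all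
qed

lemma sinv_sinv: "(s\<^sup>\<star>)\<^sup>\<star> = s"
  by (rule sinv_unique) (rule sinv_eqs)+

text \<open>\<open>s * s\<^sup>\<star>\<close> is idempotent and so commutes with \<open>f\<close>;
  moving it next to \<open>s\<^sup>\<star>\<close> or \<open>s\<close> makes it vanish.\<close>

lemma idem_sinv_commute:
  assumes "f \<in> idems"
  shows "s\<^sup>\<star> * f * s * s\<^sup>\<star> = s\<^sup>\<star> * f" "s * s\<^sup>\<star> * f * s = f * s"
proof -
  have c: "f * (s * s\<^sup>\<star>) = s * s\<^sup>\<star> * f"
    using idems_commute[OF assms sinv_mult_idems[of "s\<^sup>\<star>"]] by (simp add: sinv_sinv)
  have "s\<^sup>\<star> * f * s * s\<^sup>\<star> = s\<^sup>\<star> * (f * (s * s\<^sup>\<star>))"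
    by (simp add: mult.assoc)
  also have "\<dots> = s\<^sup>\<star> * s * s\<^sup>\<star> * f"
    by (simp add: c mult.assoc)
  finally show "s\<^sup>\<star> * f * s * s\<^sup>\<star> = s\<^sup>\<star> * f"
    by (simp add: sinv_eqs)
  have "s * s\<^sup>\<star> * f * s = f * (s * s\<^sup>\<star>) * s"
    by (simp add: c)
  also have "\<dots> = f * (s * s\<^sup>\<star> * s)"
    by (simp add: mult.assoc)
  finally show "s * s\<^sup>\<star> * f * s = f * s"
    by (simp add: sinv_eqs)
qed

lemma sinv_conj_idem:
  assumes "f \<in> idems"
  shows "s\<^sup>\<star> * f * s \<in> idems"
proof -
  have "s\<^sup>\<star> * f * s * (s\<^sup>\<star> * f * s) = s\<^sup>\<star> * f * s * s\<^sup>\<star> * (f * s)"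
    by (simp add: mult.assoc)
  also have "\<dots> = s\<^sup>\<star> * (f * f) * s"
    unfolding idem_sinv_commute(1)[OF assms] by (simp add: mult.assoc)
  finally show ?thesis
    using assms by (simp add: idems_def)
qed

lemma conj_idem: "f \<in> idems \<Longrightarrow> s * f * s\<^sup>\<star> \<in> idems"
  using sinv_conj_idem[of f "s\<^sup>\<star>"] by (simp add: sinv_sinv)

lemma sinv_mult_idem_self:
  assumes "e \<in> idems" "e \<preceq> s\<^sup>\<star> * s"
  shows "(s * e)\<^sup>\<star> * (s * e) = e"
proof -
  have "s\<^sup>\<star> * s * e = e"
    using assms nat_le_idem_iff[OF assms(1) sinv_mult_idems] by simp
  then have "e * (s\<^sup>\<star> * s * e) = e"
    using assms(1) by (simp add: idems_def)
  then show ?thesis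
    by (simp add: sinv_mult_idem[OF assms(1)] mult.assoc)
qed

section \<open>Filters\<close>

lemma filters_idems: "\<xi> \<in> filters \<Longrightarrow> e \<in> \<xi> \<Longrightarrow> e \<in> idems"
  and filters_up: "\<xi> \<in> filters \<Longrightarrow> e \<in> \<xi> \<Longrightarrow> f \<in> idems \<Longrightarrow> e \<preceq> f \<Longrightarrow> f \<in> \<xi>"
  and filters_mult: "\<xi> \<in> filters \<Longrightarrow> e \<in> \<xi> \<Longrightarrow> f \<in> \<xi> \<Longrightarrow> e * f \<in> \<xi>"
  by (auto simp: filters_def)

lemma zero_nat_le: "(0::'a::inverse_semigroup_zero) \<preceq> e"
  unfolding nat_le_def using zero_in_idems by (intro bexI[of _ 0]) simp_all

lemma filters_nonzero: "\<xi> \<in> filters \<Longrightarrow> 0 \<notin> \<xi>"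
  using zero_nat_le by (auto simp: filters_def)

text \<open>As 0 lies below every idempotent, an upward closed set of idempotents is proper exactly
  when it omits 0. This form is the convenient one for constructing filters.\<close>

lemma filters_iff:
  "\<xi> \<in> filters \<longleftrightarrow> \<xi> \<noteq> {} \<and> \<xi> \<subseteq> idems \<and> 0 \<notin> \<xi> \<and>
    (\<forall>e\<in>\<xi>. \<forall>f\<in>idems. e \<preceq> f \<longrightarrow> f \<in> \<xi>) \<and> (\<forall>e\<in>\<xi>. \<forall>f\<in>\<xi>. e * f \<in> \<xi>)"
proof
  assume "\<xi> \<in> filters"
  then show "\<xi> \<noteq> {} \<and> \<xi> \<subseteq> idems \<and> 0 \<notin> \<xi> \<and>
    (\<forall>e\<in>\<xi>. \<forall>f\<in>idems. e \<preceq> f \<longrightarrow> f \<in> \<xi>) \<and> (\<forall>e\<in>\<xi>. \<forall>f\<in>\<xi>. e * f \<in> \<xi>)"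
    using filters_nonzero[of \<xi>] unfolding filters_def by blast
next
  assume a: "\<xi> \<noteq> {} \<and> \<xi> \<subseteq> idems \<and> 0 \<notin> \<xi> \<and>
    (\<forall>e\<in>\<xi>. \<forall>f\<in>idems. e \<preceq> f \<longrightarrow> f \<in> \<xi>) \<and> (\<forall>e\<in>\<xi>. \<forall>f\<in>\<xi>. e * f \<in> \<xi>)"
  then have "\<xi> \<subset> idems"
    using zero_in_idems by blast
  with a show "\<xi> \<in> filters"
    unfolding filters_def by simp
qed

lemma filters_prod:
  assumes "\<xi> \<in> filters" "finite X" "X \<subseteq> \<xi>"
  shows "\<exists>e\<in>\<xi>. \<forall>x\<in>X. e \<preceq> x"
  using assms(2,3)
proof (induction X rule: finite_induct)
  case empty
  then show ?case
    using assms(1) by (auto simp: filters_def)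
next
  case (insert x X)
  then obtain e where e: "e \<in> \<xi>" "\<forall>x\<in>X. e \<preceq> x" "x \<in> \<xi>"
    by auto
  then have "e * x \<preceq> e" "e * x \<preceq> x"
    using idem_mult_nat_le filters_idems[OF assms(1)] by blast+
  then show ?case
    using e filters_mult[OF assms(1) e(1,3)] nat_le_trans by blast
qed

section \<open>Ultrafilters: how they omit elements, and their existence\<close>

lemma ultrafilters_subset_filters: "\<xi> \<in> ultrafilters \<Longrightarrow> \<xi> \<in> filters"
  by (simp add: ultrafilters_def)

text \<open>If no member of \<open>\<xi>\<close> annihilates \<open>c\<close>, the idempotents above
  the products \<open>g * c\<close> with \<open>g \<in> \<xi>\<close> form a filter containing both
  \<open>\<xi>\<close> and \<open>c\<close>, against maximality. Absence from an ultrafilter is thus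
  witnessed by a member of it.\<close>

lemma ultrafilter_notin:
  assumes "\<xi> \<in> ultrafilters" "c \<in> idems" "c \<notin> \<xi>"
  shows "\<exists>g\<in>\<xi>. g * c = 0"
proof (rule ccontr)
  assume nz: "\<not> (\<exists>g\<in>\<xi>. g * c = 0)"
  have \<xi>: "\<xi> \<in> filters"
    using assms ultrafilters_subset_filters by blast
  define \<eta> where "\<eta> = {f \<in> idems. \<exists>g\<in>\<xi>. g * c \<preceq> f}"
  have sub: "\<xi> \<subseteq> \<eta>" and c: "c \<in> \<eta>"
    using \<xi> assms(2) idem_mult_nat_le filters_idems[OF \<xi>] unfolding \<eta>_def filters_def by blast+
  have "\<eta> \<in> filters"
    unfolding filters_iff
  proof (intro conjI ballI impI)
    show "\<eta> \<noteq> {}"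
      using c by blast
    show "\<eta> \<subseteq> idems"
      by (auto simp: \<eta>_def)
    show "0 \<notin> \<eta>"
      using nz by (auto simp: \<eta>_def nat_le_idem_iff zero_in_idems idems_mult assms(2) filters_idems[OF \<xi>])
    show "f \<in> \<eta>" if "e \<in> \<eta>" "f \<in> idems" "e \<preceq> f" for e f
      using that nat_le_trans unfolding \<eta>_def by blast
    fix e f assume "e \<in> \<eta>" "f \<in> \<eta>"
    then obtain g h where gh: "e \<in> idems" "f \<in> idems" "g \<in> \<xi>" "h \<in> \<xi>" "g * c \<preceq> e" "h * c \<preceq> f"
      by (auto simp: \<eta>_def)
    have I: "g \<in> idems" "h \<in> idems" "g * h \<in> idems" "g * h \<in> \<xi>"
      using gh filters_idems[OF \<xi>] filters_mult[OF \<xi>] idems_mult by blast+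
    \<comment> \<open>All factors commute and \<open>c\<close> is idempotent, so the product of the
      lower bounds \<open>g * c\<close> and \<open>h * c\<close> is \<open>g * h * c\<close>, again
      a bound of the required shape.\<close>
    have "g * h * c \<preceq> e * f"
    proof -
      have "e * (g * c) = g * c" "f * (h * c) = h * c"
        using gh I assms(2) nat_le_idem_iff idems_mult by blast+
      moreover have "e * f * (g * h * c) = (e * (g * c)) * (f * (h * c))"
      proof -
        have l: "x * (y * z) = y * (x * z)" if "x \<in> idems" "y \<in> idems" for x y z :: 'a
          using idems_commute[OF that] by (metis mult.assoc)
        have cc: "c * c = c"
          using assms(2) by (simp add: idems_def)
        have "(e * (g * c)) * (f * (h * c)) = e * (g * (c * (f * (h * c))))"
          by (simp add: mult.assoc)
        also have "\<dots> = e * (g * (f * (h * (c * c))))"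
          by (simp add: l[of c] assms(2) gh I)
        also have "\<dots> = e * (f * (g * (h * c)))"
          by (simp add: l[of g f] gh I cc)
        finally show ?thesis
          by (simp add: mult.assoc)
      qed
      moreover have "(g * c) * (h * c) = g * h * c"
      proof -
        have "(g * c) * (h * c) = g * (h * (c * c))"
          using idems_commute[OF assms(2) I(2)] by (metis mult.assoc)
        then show ?thesis
          using assms(2) by (simp add: idems_def mult.assoc)
      qed
      ultimately have "e * f * (g * h * c) = g * h * c"
        by simp
      then show ?thesis
        using nat_le_idem_iff gh I assms(2) idems_mult by metis
    qed
    then show "e * f \<in> \<eta>"
      using I idems_mult gh unfolding \<eta>_def by blast
  qed
  then show False
    using sub c assms unfolding ultrafilters_def by blast
qed

text \<open>Zorn's lemma is applied to the filters containing \<open>e\<close>. The principal filter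
  of \<open>e\<close> is one of them, being proper because \<open>e \<noteq> 0\<close>.\<close>

lemma ex_ultrafilter:
  fixes e :: "'a::inverse_semigroup_zero"
  assumes "e \<in> idems" "e \<noteq> 0"
  shows "\<exists>\<xi>\<in>ultrafilters. e \<in> \<xi>"
proof -
  define A where "A = {\<eta> \<in> filters. e \<in> \<eta>}"
  have "{f \<in> idems. e \<preceq> f} \<in> filters"
    unfolding filters_iff
  proof (intro conjI ballI impI)
    show "{f \<in> idems. e \<preceq> f} \<noteq> {}"
      using assms unfolding nat_le_def idems_def by force
    show "0 \<notin> {f \<in> idems. e \<preceq> f}"
      using assms by (simp add: nat_le_idem_iff zero_in_idems)
    show "f \<in> {f \<in> idems. e \<preceq> f}" if "a \<in> {f \<in> idems. e \<preceq> f}" "f \<in> idems" "a \<preceq> f" for a f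
      using that nat_le_trans by blast
    show "a * b \<in> {f \<in> idems. e \<preceq> f}"
      if "a \<in> {f \<in> idems. e \<preceq> f}" "b \<in> {f \<in> idems. e \<preceq> f}" for a b
      using that assms by (auto simp: nat_le_idem_iff idems_mult mult.assoc)
  qed auto
  then have ne: "A \<noteq> {}"
    using assms unfolding A_def nat_le_def idems_def by force
  have "\<Union>C \<in> A" if C: "C \<noteq> {}" "subset.chain A C" for C
  proof -
    have sub: "C \<subseteq> A" and lin: "X \<subseteq> Y \<or> Y \<subseteq> X" if "X \<in> C" "Y \<in> C" for X Y
      using C that by (auto simp: subset.chain_def)
    have F: "X \<in> filters" "e \<in> X" if "X \<in> C" for X
      using sub that C by (auto simp: A_def)
    have "\<Union>C \<in> filters"
      unfolding filters_iff
    proof (intro conjI ballI impI)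
      show "a * b \<in> \<Union>C" if ab: "a \<in> \<Union>C" "b \<in> \<Union>C" for a b
      proof -
        obtain X where "X \<in> C" "a \<in> X" "b \<in> X"
          using ab lin by (metis UnionE subsetD)
        then show ?thesis
          using filters_mult F by blast
      qed
      show "\<Union>C \<noteq> {}"
        using F(2) C(1) by blast
      show "\<Union>C \<subseteq> idems"
        using F(1) filters_idems by blast
      show "0 \<notin> \<Union>C"
        using F(1) filters_nonzero by blast
      show "f \<in> \<Union>C" if "a \<in> \<Union>C" "f \<in> idems" "a \<preceq> f" for a f
        using that F(1) filters_up by blast
    qed
    then show ?thesis
      using F C by (auto simp: A_def)
  qed
  then obtain M where M: "M \<in> A" "\<forall>X\<in>A. M \<subseteq> X \<longrightarrow> X = M"
    using subset_Zorn_nonempty[OF ne] by blast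
  \<comment> \<open>A filter above \<open>M\<close> still contains \<open>e\<close>, so maximality
    within \<open>A\<close> is maximality among all filters.\<close>
  then have "M \<in> ultrafilters"
    unfolding ultrafilters_def A_def by blast
  then show ?thesis
    using M by (auto simp: A_def)
qed

section \<open>The space of tight filters\<close>

lemma openin_filter_topology:
  "openin filter_topology U \<longleftrightarrow>
    (\<exists>V. openin (product_topology (\<lambda>_. discrete_topology (UNIV :: bool set)) idems) V \<and>
      U = (\<lambda>\<xi>. restrict (\<lambda>e. e \<in> \<xi>) idems) -` V \<inter> filters)"
  by (auto simp: filter_topology_def openin_pullback_topology)

lemma topspace_filter_topology: "topspace filter_topology = filters"
  by (auto simp: filter_topology_def topspace_pullback_topology)

lemma topspace_tight_topology: "topspace tight_topology = tight_filters"
  using tight_filters_subset by (auto simp: tight_topology_def topspace_filter_topology)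

lemma ultrafilters_subset_tight: "ultrafilters \<subseteq> tight_filters"
  unfolding tight_filters_def
  by (intro closure_of_subset) (auto simp: topspace_filter_topology ultrafilters_def)

lemma tight_open_dense:
  assumes "openin tight_topology U" "\<xi> \<in> U"
  shows "\<exists>\<eta>\<in>ultrafilters. \<eta> \<in> U"
proof -
  obtain V where V: "openin filter_topology V" "U = V \<inter> tight_filters"
    using assms by (auto simp: tight_topology_def openin_subtopology)
  then have "\<xi> \<in> filter_topology closure_of ultrafilters" "\<xi> \<in> V"
    using assms by (auto simp: tight_filters_def)
  then obtain \<eta> where "\<eta> \<in> ultrafilters" "\<eta> \<in> V"
    using V(1) unfolding in_closure_of by blast
  then show ?thesis
    using V(2) ultrafilters_subset_tight by blast
qed

section \<open>Membership as a clopen condition, and compactness\<close>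

lemma openin_coordinate:
  assumes "e \<in> I"
  shows "openin (product_topology (\<lambda>_. discrete_topology (UNIV :: bool set)) I)
    {x \<in> topspace (product_topology (\<lambda>_. discrete_topology UNIV) I). x e \<in> B}"
  by (rule openin_continuous_map_preimage[OF continuous_map_product_projection[OF assms]]) simp

lemma closedin_coordinate:
  assumes "e \<in> I"
  shows "closedin (product_topology (\<lambda>_. discrete_topology (UNIV :: bool set)) I)
    {x \<in> topspace (product_topology (\<lambda>_. discrete_topology UNIV) I). x e \<in> B}"
  by (rule closedin_continuous_map_preimage[OF continuous_map_product_projection[OF assms]]) simp

text \<open>With \<open>B\<close> equal to \<open>{True}\<close> or \<open>{False}\<close> this
  covers membership and non-membership of \<open>e\<close> at once.\<close>

lemma openin_filters_coordinate:
  assumes "e \<in> idems"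
  shows "openin filter_topology {\<xi> \<in> filters. (e \<in> \<xi>) \<in> B}"
  unfolding openin_filter_topology
  by (rule exI, rule conjI, rule openin_coordinate[OF assms, of B]) (use assms in auto)

lemma openin_D_set:
  assumes "e \<in> idems"
  shows "openin tight_topology (D_set e)" "openin tight_topology (tight_filters - D_set e)"
proof -
  have "D_set e = {\<xi> \<in> filters. (e \<in> \<xi>) \<in> {True}} \<inter> tight_filters"
    "tight_filters - D_set e = {\<xi> \<in> filters. (e \<in> \<xi>) \<in> {False}} \<inter> tight_filters"
    using tight_filters_subset by (auto simp: D_set_def)
  then show "openin tight_topology (D_set e)" "openin tight_topology (tight_filters - D_set e)"
    unfolding tight_topology_def openin_subtopology
    using openin_filters_coordinate[OF assms] by blast+
qed

lemma compactin_pullback_topology: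
  assumes "compactin T (f ` S)" "S \<subseteq> A"
  shows "compactin (pullback_topology A f T) S"
  unfolding compactin_def
proof (intro conjI allI impI)
  show "S \<subseteq> topspace (pullback_topology A f T)"
    using assms compactin_subset_topspace[OF assms(1)] by (auto simp: topspace_pullback_topology)
  fix \<U> assume \<U>: "Ball \<U> (openin (pullback_topology A f T)) \<and> S \<subseteq> \<Union>\<U>"
  then have "\<forall>U\<in>\<U>. \<exists>V. openin T V \<and> U = f -` V \<inter> A"
    by (simp add: openin_pullback_topology)
  then obtain V where V: "\<And>U. U \<in> \<U> \<Longrightarrow> openin T (V U)" "\<And>U. U \<in> \<U> \<Longrightarrow> U = f -` V U \<inter> A"
    by metis
  have "f ` S \<subseteq> \<Union>(V ` \<U>)"
  proof
    fix y assume "y \<in> f ` S"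
    then obtain x where x: "x \<in> S" "y = f x"
      by blast
    then obtain U where U: "U \<in> \<U>" "x \<in> U"
      using \<U> by blast
    then show "y \<in> \<Union>(V ` \<U>)"
      using V(2)[OF U(1)] x by blast
  qed
  moreover have "openin T W" if "W \<in> V ` \<U>" for W
    using that V(1) by (elim imageE) simp
  ultimately have "\<exists>\<F>. finite \<F> \<and> \<F> \<subseteq> V ` \<U> \<and> f ` S \<subseteq> \<Union>\<F>"
    by (intro compactinD[OF assms(1)])
  then obtain \<F> where \<F>: "finite \<F>" "\<F> \<subseteq> V ` \<U>" "f ` S \<subseteq> \<Union>\<F>"
    by (elim exE conjE)
  then obtain \<G> where \<G>: "\<G> \<subseteq> \<U>" "finite \<G>" "\<F> = V ` \<G>"
    by (meson finite_subset_image)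
  have "S \<subseteq> \<Union>\<G>"
  proof
    fix x assume x: "x \<in> S"
    then obtain U where U: "U \<in> \<G>" "f x \<in> V U"
      using \<F>(3) \<G>(3) by blast
    then show "x \<in> \<Union>\<G>"
      using V(2)[of U] \<G>(1) x assms(2) by blast
  qed
  then show "\<exists>\<F>. finite \<F> \<and> \<F> \<subseteq> \<U> \<and> S \<subseteq> \<Union>\<F>"
    using \<G> by blast
qed

text \<open>The characteristic functions of these filters form a closed subset of the compact
  product. Prescribing the member \<open>e\<close> replaces nonemptiness, which is only an open
  condition, by a closed one.\<close>

lemma compactin_filters_containing:
  fixes e :: "'a::inverse_semigroup_zero"
  assumes e: "e \<in> idems"
  shows "compactin filter_topology {\<xi> \<in> filters. e \<in> \<xi>}"
proof -
  let ?P = "product_topology (\<lambda>_. discrete_topology (UNIV :: bool set)) (idems :: 'a set)"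
  let ?r = "\<lambda>\<xi>. restrict (\<lambda>e. e \<in> \<xi>) (idems :: 'a set)"
  define A where "A a = {x \<in> topspace ?P. x a}" for a
  define N where "N a = {x \<in> topspace ?P. \<not> x a}" for a
  \<comment> \<open>The filter axioms in the form of \<open>filters_iff\<close>: each implication
    between coordinates becomes a finite union of closed coordinate conditions \<open>N\<close> and
    \<open>A\<close>.\<close>
  define Z where "Z = (A e \<inter> N 0) \<inter>
    ((\<Inter>p\<in>{(a, b). a \<in> idems \<and> b \<in> idems \<and> a \<preceq> b}. N (fst p) \<union> A (snd p)) \<inter>
     (\<Inter>p\<in>idems \<times> idems. N (fst p) \<union> (N (snd p) \<union> A (fst p * snd p))))"
  have A: "closedin ?P (A a)" and N: "closedin ?P (N a)" if "a \<in> idems" for a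
    using closedin_coordinate[OF that, of "{True}"] closedin_coordinate[OF that, of "{False}"]
    by (simp_all add: A_def N_def)
  have "closedin ?P Z"
    unfolding Z_def
  proof (intro closedin_Int closedin_INT closedin_Un A N e zero_in_idems)
    \<comment> \<open>The intersections must run over nonempty index sets; \<open>e\<close> provides
      an index for each.\<close>
    have "(e, e) \<in> {(a, b). a \<in> idems \<and> b \<in> idems \<and> a \<preceq> b}"
      using e by (simp add: nat_le_idem_iff) (simp add: idems_def)
    then show "{(a, b). a \<in> idems \<and> b \<in> idems \<and> a \<preceq> (b::'a)} \<noteq> {}"
      by blast
    show "(idems \<times> idems :: ('a \<times> 'a) set) \<noteq> {}"
      using e by blast
  qed (auto simp: idems_mult)
  moreover have "compact_space ?P"
    by (simp add: compact_space_product_topology compact_space_discrete_topology)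
  ultimately have "compactin ?P Z"
    by (rule closedin_compact_space[rotated])
  moreover have "?r ` {\<xi> \<in> filters. e \<in> \<xi>} = Z"
  proof (intro equalityI subsetI)
    fix x assume "x \<in> ?r ` {\<xi> \<in> filters. e \<in> \<xi>}"
    then obtain \<xi> where \<xi>: "x = ?r \<xi>" "\<xi> \<in> filters" "e \<in> \<xi>"
      by blast
    have xi: "x a \<longleftrightarrow> a \<in> \<xi>" if "a \<in> idems" for a
      using that by (simp add: \<xi>(1))
    have "x \<in> topspace ?P"
      by (simp add: \<xi>(1))
    moreover have "x b" if "a \<in> idems" "b \<in> idems" "a \<preceq> b" "x a" for a b
      using that filters_up[OF \<xi>(2)] by (simp add: xi)
    moreover have "x (a * b)" if "a \<in> idems" "b \<in> idems" "x a" "x b" for a b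
      using that filters_mult[OF \<xi>(2)] by (simp add: xi idems_mult)
    moreover have "x e" "\<not> x 0"
      using \<xi> filters_nonzero by (simp_all add: xi e zero_in_idems)
    ultimately show "x \<in> Z"
      unfolding Z_def A_def N_def by auto
  next
    fix x assume x: "x \<in> Z"
    define \<xi> where "\<xi> = {a \<in> idems. x a}"
    have xe: "x e" "\<not> x 0" and top: "x \<in> topspace ?P"
      using x unfolding Z_def A_def N_def by blast+
    have up: "x b" if "a \<in> idems" "b \<in> idems" "a \<preceq> b" "x a" for a b
    proof -
      have "x \<in> N (fst (a, b)) \<union> A (snd (a, b))"
        using x that unfolding Z_def by blast
      then show ?thesis
        using that by (simp add: A_def N_def)
    qed
    have mult: "x (a * b)" if "a \<in> idems" "b \<in> idems" "x a" "x b" for a b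
    proof -
      have "x \<in> N (fst (a, b)) \<union> (N (snd (a, b)) \<union> A (fst (a, b) * snd (a, b)))"
        using x that unfolding Z_def by blast
      then show ?thesis
        using that by (simp add: A_def N_def)
    qed
    have "\<xi> \<in> filters"
      unfolding filters_iff
    proof (intro conjI ballI impI)
      show "\<xi> \<noteq> {}" "\<xi> \<subseteq> idems" "0 \<notin> \<xi>"
        using xe e by (auto simp: \<xi>_def)
      show "b \<in> \<xi>" if "a \<in> \<xi>" "b \<in> idems" "a \<preceq> b" for a b
        using that up[of a b] by (simp add: \<xi>_def)
      show "a * b \<in> \<xi>" if "a \<in> \<xi>" "b \<in> \<xi>" for a b
        using that mult[of a b] by (simp add: \<xi>_def idems_mult)
    qed
    \<comment> \<open>Outside \<open>idems\<close> both functions are \<open>undefined\<close>,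
      since points of the product are extensional.\<close>
    moreover have "x = ?r \<xi>"
    proof
      fix a show "x a = ?r \<xi> a"
        using top by (cases "a \<in> idems") (auto simp: \<xi>_def PiE_def extensional_def)
    qed
    moreover have "e \<in> \<xi>"
      using xe e by (simp add: \<xi>_def)
    ultimately show "x \<in> ?r ` {\<xi> \<in> filters. e \<in> \<xi>}"
      by blast
  qed
  ultimately have "compactin ?P (?r ` {\<xi> \<in> filters. e \<in> \<xi>})"
    by simp
  then show ?thesis
    unfolding filter_topology_def by (rule compactin_pullback_topology) blast
qed

lemma compactin_D_set:
  assumes "e \<in> idems"
  shows "compactin tight_topology (D_set e)"
proof -
  have "closedin filter_topology tight_filters"
    by (simp add: tight_filters_def)
  then have "compactin filter_topology ({\<xi> \<in> filters. e \<in> \<xi>} \<inter> tight_filters)"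
    by (rule compact_Int_closedin[OF compactin_filters_containing[OF assms]])
  moreover have "{\<xi> \<in> filters. e \<in> \<xi>} \<inter> tight_filters = D_set e"
    using tight_filters_subset by (auto simp: D_set_def)
  ultimately show ?thesis
    unfolding tight_topology_def compactin_subtopology by (auto simp: D_set_def)
qed

text \<open>A basic neighbourhood restricts finitely many coordinates. A required absence of
  \<open>y\<close> is enforced by a member of \<open>\<eta>\<close> annihilating \<open>y\<close>,
  so one element below all the witnesses controls every coordinate.\<close>

lemma ultrafilter_neighbourhood:
  assumes U: "openin tight_topology U" and \<eta>: "\<eta> \<in> ultrafilters" "\<eta> \<in> U"
  shows "\<exists>e\<in>\<eta>. D_set e \<subseteq> U"
proof -
  let ?r = "\<lambda>\<xi>. restrict (\<lambda>e. e \<in> \<xi>) idems"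
  have F: "\<eta> \<in> filters"
    using \<eta> ultrafilters_subset_filters by blast
  obtain V where V: "openin (product_topology (\<lambda>_. discrete_topology (UNIV :: bool set)) idems) V"
    "U = ?r -` V \<inter> filters \<inter> tight_filters"
    using U by (auto simp: tight_topology_def openin_subtopology openin_filter_topology)
  have "\<forall>x\<in>V. \<exists>W. finite {i \<in> idems. W i \<noteq> (UNIV :: bool set)} \<and> x \<in> Pi\<^sub>E idems W \<and>
      Pi\<^sub>E idems W \<subseteq> V"
    using V(1) unfolding openin_product_topology_alt by simp
  moreover have "?r \<eta> \<in> V"
    using \<eta> V by blast
  ultimately obtain W where W: "finite {i \<in> idems. W i \<noteq> (UNIV :: bool set)}" "?r \<eta> \<in> Pi\<^sub>E idems W"
    "Pi\<^sub>E idems W \<subseteq> V"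
    by blast
  define N where "N = {i \<in> idems. W i \<noteq> UNIV}"
  \<comment> \<open>A filter containing the witness \<open>g\<close> agrees with
    \<open>\<eta>\<close> at \<open>y\<close>: either \<open>g\<close> is \<open>y\<close> itself,
    or \<open>g * y = 0\<close> excludes \<open>y\<close>.\<close>
  have "\<forall>y\<in>N. \<exists>g\<in>\<eta>. y \<in> \<eta> \<and> g = y \<or> y \<notin> \<eta> \<and> g * y = 0"
    using ultrafilter_notin[OF \<eta>(1)] by (auto simp: N_def)
  then obtain g where g: "\<And>y. y \<in> N \<Longrightarrow> g y \<in> \<eta>"
    "\<And>y. y \<in> N \<Longrightarrow> y \<in> \<eta> \<and> g y = y \<or> y \<notin> \<eta> \<and> g y * y = 0"
    by metis
  obtain e where e: "e \<in> \<eta>" "\<forall>x\<in>g ` N. e \<preceq> x"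
    using filters_prod[OF F, of "g ` N"] g W(1) by (auto simp: N_def)
  have "\<zeta> \<in> U" if "\<zeta> \<in> D_set e" for \<zeta>
  proof -
    have \<zeta>: "\<zeta> \<in> tight_filters" "\<zeta> \<in> filters" "e \<in> \<zeta>"
      using that tight_filters_subset by (auto simp: D_set_def)
    have same: "(y \<in> \<zeta>) = (y \<in> \<eta>)" if y: "y \<in> N" for y
    proof -
      have "g y \<in> \<zeta>"
        using filters_up[OF \<zeta>(2,3)] e(2) g(1)[OF y] filters_idems[OF F] y by blast
      then show ?thesis
        using g(2)[OF y] filters_mult[OF \<zeta>(2)] filters_nonzero[OF \<zeta>(2)] by metis
    qed
    have "?r \<zeta> \<in> Pi\<^sub>E idems W"
    proof (rule PiE_I)
      fix i :: 'a assume i: "i \<in> idems"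
      then have "(i \<in> \<eta>) \<in> W i"
        using W(2) by (auto simp: PiE_iff)
      then show "?r \<zeta> i \<in> W i"
        using i same[of i] by (cases "W i = UNIV") (auto simp: N_def)
    qed simp
    then show ?thesis
      using W(3) V(2) \<zeta> by blast
  qed
  then show ?thesis
    using e(1) by blast
qed

section \<open>Weakly fixed idempotents and fixed tight filters\<close>

text \<open>Conjugating by \<open>s\<^sup>\<star>\<close> carries the comparison with
  \<open>f\<close> back to the domain of \<open>s\<close>. Membership of \<open>f\<close> in the
  image then depends on a single coordinate of \<open>\<xi>\<close>, hence is a clopen
  condition.\<close>

lemma theta_iff:
  assumes \<xi>: "\<xi> \<in> filters" and s: "s\<^sup>\<star> * s \<in> \<xi>"
  shows "f \<in> theta s \<xi> \<longleftrightarrow> f \<in> idems \<and> s\<^sup>\<star> * f * s \<in> \<xi>"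
proof (intro iffI conjI)
  assume "f \<in> theta s \<xi>"
  then obtain e where f: "f \<in> idems" and e: "e \<in> \<xi>" "s * e * s\<^sup>\<star> \<preceq> f"
    by (auto simp: theta_def)
  show "f \<in> idems"
    by (rule f)
  have I: "e \<in> idems"
    using filters_idems[OF \<xi> e(1)] .
  have "f * (s * e * s\<^sup>\<star>) = s * e * s\<^sup>\<star>"
    using nat_le_idem_iff[OF conj_idem[OF I] f] e(2) by blast
  then have "f * (s * e * s\<^sup>\<star> * s) = s * e * s\<^sup>\<star> * s"
    by (metis mult.assoc)
  moreover have "s * e * s\<^sup>\<star> * s = s * e"
    using idems_commute[OF I sinv_mult_idems[of s]] sinv_eqs(1)[of s] by (metis mult.assoc)
  ultimately have fse: "f * (s * e) = s * e"
    by simp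
  have "s\<^sup>\<star> * f * s * (s\<^sup>\<star> * s * e) = s\<^sup>\<star> * f * s * s\<^sup>\<star> * (s * e)"
    by (simp add: mult.assoc)
  also have "\<dots> = s\<^sup>\<star> * (f * (s * e))"
    unfolding idem_sinv_commute(1)[OF f] by (simp add: mult.assoc)
  also have "\<dots> = s\<^sup>\<star> * s * e"
    unfolding fse by (simp add: mult.assoc)
  finally have "s\<^sup>\<star> * f * s * (s\<^sup>\<star> * s * e) = s\<^sup>\<star> * s * e" .
  then have "s\<^sup>\<star> * s * e \<preceq> s\<^sup>\<star> * f * s"
    using nat_le_idem_iff[OF idems_mult[OF sinv_mult_idems I] sinv_conj_idem[OF f]] by blast
  then show "s\<^sup>\<star> * f * s \<in> \<xi>"
    using filters_up[OF \<xi> filters_mult[OF \<xi> s e(1)] sinv_conj_idem[OF f]] by blast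
next
  assume f: "f \<in> idems \<and> s\<^sup>\<star> * f * s \<in> \<xi>"
  then have I: "f \<in> idems"
    by blast
  \<comment> \<open>The witness for membership in \<open>theta s \<xi>\<close> is
    \<open>s\<^sup>\<star> * f * s\<close> itself.\<close>
  have "s * (s\<^sup>\<star> * f * s) * s\<^sup>\<star> = f * (s * s\<^sup>\<star>)"
    using idem_sinv_commute(2)[OF I, of s] by (simp add: mult.assoc)
  then have "s * (s\<^sup>\<star> * f * s) * s\<^sup>\<star> \<preceq> f"
    using sinv_mult_idems[of "s\<^sup>\<star>"] by (auto simp: nat_le_def sinv_sinv)
  then show "f \<in> theta s \<xi>"
    using f by (auto simp: theta_def)
qed

text \<open>In view of \<open>theta_iff\<close>, this says that \<open>theta s\<close> fixes
  \<open>\<xi>\<close>. If just one of \<open>h\<close> and its conjugate lay in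
  \<open>\<xi>\<close>, some member of \<open>\<xi>\<close> would annihilate the other, and
  multiplying these members with \<open>e\<close> would give a nonzero \<open>k\<close> below
  \<open>e\<close> with \<open>s * k * s\<^sup>\<star> * k = 0\<close>.\<close>

lemma weakly_fixed_ultrafilter:
  assumes w: "weakly_fixed s e" and \<xi>: "\<xi> \<in> ultrafilters" and e: "e \<in> \<xi>" and h: "h \<in> idems"
  shows "s\<^sup>\<star> * h * s \<in> \<xi> \<longleftrightarrow> h \<in> \<xi>"
proof -
  have F: "\<xi> \<in> filters"
    by (rule ultrafilters_subset_filters[OF \<xi>])
  have nz: "s * k * s\<^sup>\<star> * k \<noteq> 0" if k: "g \<in> \<xi>" "j \<in> \<xi>" "k = e * (g * j)" for g j k
  proof -
    have gj: "g * j \<in> \<xi>"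
      by (rule filters_mult[OF F k(1,2)])
    then have "k \<in> \<xi>"
      unfolding k(3) by (rule filters_mult[OF F e])
    then have "k \<in> idems" "k \<noteq> 0"
      using filters_idems[OF F] filters_nonzero[OF F] by auto
    moreover have "k \<preceq> e"
      unfolding k(3) by (rule idem_mult_nat_le(1)[OF filters_idems[OF F e] filters_idems[OF F gj]])
    ultimately show ?thesis
      using w by (simp add: weakly_fixed_def)
  qed
  have I: "x \<in> idems" if "x \<in> \<xi>" for x
    using filters_idems[OF F that] .
  have h2: "s\<^sup>\<star> * h * s * s\<^sup>\<star> = s\<^sup>\<star> * h"
    by (rule idem_sinv_commute[OF h])
  have hI: "s\<^sup>\<star> * h * s \<in> idems"
    by (rule sinv_conj_idem[OF h])
  show ?thesis
  proof
    assume a: "s\<^sup>\<star> * h * s \<in> \<xi>"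
    show "h \<in> \<xi>"
    proof (rule ccontr)
      assume "h \<notin> \<xi>"
      then obtain g where g: "g \<in> \<xi>" "g * h = 0"
        using ultrafilter_notin[OF \<xi> h] by blast
      \<comment> \<open>As \<open>k\<close> lies below \<open>s\<^sup>\<star> * h * s\<close>, the
        conjugate \<open>s * k * s\<^sup>\<star>\<close> lies below \<open>h\<close>, while
        \<open>h * k\<close> contains the factor \<open>g * h = 0\<close>.\<close>
      define k where "k = e * (g * (s\<^sup>\<star> * h * s))"
      have "s * k * s\<^sup>\<star> * k = s * (e * g) * (s\<^sup>\<star> * h * s * s\<^sup>\<star>) * k"
        by (simp add: k_def mult.assoc)
      also have "\<dots> = s * (e * g) * s\<^sup>\<star> * (h * k)"
        unfolding h2 by (simp add: mult.assoc)
      also have "h * k = h * e * (g * (s\<^sup>\<star> * h * s))"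
        by (simp add: k_def mult.assoc)
      also have "\<dots> = e * (h * g) * (s\<^sup>\<star> * h * s)"
        unfolding idems_commute[OF h I[OF e]] by (simp add: mult.assoc)
      also have "\<dots> = e * (g * h) * (s\<^sup>\<star> * h * s)"
        unfolding idems_commute[OF h I[OF g(1)]] ..
      finally show False
        using nz[OF g(1) a k_def] g(2) by simp
    qed
  next
    assume a: "h \<in> \<xi>"
    show "s\<^sup>\<star> * h * s \<in> \<xi>"
    proof (rule ccontr)
      assume "s\<^sup>\<star> * h * s \<notin> \<xi>"
      then obtain g where g: "g \<in> \<xi>" "g * (s\<^sup>\<star> * h * s) = 0"
        using ultrafilter_notin[OF \<xi> hI] by blast
      \<comment> \<open>Now \<open>k\<close> annihilates \<open>s\<^sup>\<star> * h * s\<close>, so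
        \<open>s * k * s\<^sup>\<star>\<close> annihilates \<open>h\<close> and with it
        \<open>k\<close>, which lies below \<open>h\<close>.\<close>
      define k where "k = e * (h * g)"
      have "k * (s\<^sup>\<star> * h) = k * (s\<^sup>\<star> * h * s * s\<^sup>\<star>)"
        unfolding h2 ..
      also have "\<dots> = e * h * (g * (s\<^sup>\<star> * h * s)) * s\<^sup>\<star>"
        by (simp add: k_def mult.assoc)
      also have "\<dots> = 0"
        by (simp add: g(2))
      finally have "s * (k * (s\<^sup>\<star> * h)) * k = 0"
        by simp
      then have "s * k * s\<^sup>\<star> * (h * k) = 0"
        by (simp add: mult.assoc)
      moreover have "h * k = k"
      proof -
        have "h * k = h * e * (h * g)"
          by (simp add: k_def mult.assoc)
        also have "\<dots> = e * (h * h) * g"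
          unfolding idems_commute[OF h I[OF e]] by (simp add: mult.assoc)
        also have "h * h = h"
          using h by (simp add: idems_def)
        finally show ?thesis
          by (simp add: k_def mult.assoc)
      qed
      ultimately show False
        using nz[OF a g(1) k_def] by simp
    qed
  qed
qed

lemma D_set_mono: "e \<preceq> f \<Longrightarrow> f \<in> idems \<Longrightarrow> D_set e \<subseteq> D_set f"
  using filters_up tight_filters_subset unfolding D_set_def by blast

text \<open>Whether \<open>\<theta>\<^sub>s\<close> moves \<open>\<xi>\<close> is witnessed by finitely many coordinates of \<open>\<xi>\<close>, so a
  non-fixed tight filter would force a nearby non-fixed ultrafilter.\<close>

lemma W_set_iff:
  "e \<in> W_set s \<longleftrightarrow> e \<in> idems \<and> e \<preceq> s\<^sup>\<star> * s \<and> (\<forall>\<xi>\<in>D_set e. theta s \<xi> = \<xi>)"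
proof (intro iffI conjI ballI)
  assume "e \<in> W_set s"
  then have w: "weakly_fixed s e"
    by (simp add: W_set_def)
  then show e: "e \<in> idems" and le: "e \<preceq> s\<^sup>\<star> * s"
    by (auto simp: weakly_fixed_def)
  fix \<xi> assume \<xi>: "\<xi> \<in> D_set e"
  have F: "\<xi> \<in> filters" "s\<^sup>\<star> * s \<in> \<xi>" "\<xi> \<in> tight_filters"
    using \<xi> D_set_mono[OF le sinv_mult_idems] tight_filters_subset by (auto simp: D_set_def)
  have "s\<^sup>\<star> * h * s \<in> \<xi> \<longleftrightarrow> h \<in> \<xi>" if h: "h \<in> idems" for h
  proof (rule ccontr)
    assume n: "\<not> ?thesis"
    have hI: "s\<^sup>\<star> * h * s \<in> idems"
      by (rule sinv_conj_idem[OF h])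
    \<comment> \<open>The tight filters through \<open>e\<close> that contain exactly one of
      \<open>h\<close> and its conjugate.\<close>
    define U where "U = D_set e \<inter>
      ((D_set h \<inter> (tight_filters - D_set (s\<^sup>\<star> * h * s))) \<union>
       (D_set (s\<^sup>\<star> * h * s) \<inter> (tight_filters - D_set h)))"
    have "openin tight_topology U"
      unfolding U_def by (intro openin_Int openin_Un openin_D_set e h hI)
    moreover have "\<xi> \<in> U"
      using n \<xi> F by (auto simp: U_def D_set_def)
    ultimately obtain \<eta> where "\<eta> \<in> ultrafilters" "\<eta> \<in> U"
      using tight_open_dense by blast
    then show False
      using weakly_fixed_ultrafilter[OF w _ _ h, of \<eta>] by (auto simp: U_def D_set_def)
  qed
  then show "theta s \<xi> = \<xi>"
    using theta_iff[OF F(1,2)] filters_idems[OF F(1)] by blast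
next
  assume a: "e \<in> idems \<and> e \<preceq> s\<^sup>\<star> * s \<and> (\<forall>\<xi>\<in>D_set e. theta s \<xi> = \<xi>)"
  \<comment> \<open>An ultrafilter through \<open>f\<close> is fixed, so it contains both
    \<open>f\<close> and \<open>s * f * s\<^sup>\<star>\<close>, and their product cannot
    vanish.\<close>
  have "s * f * s\<^sup>\<star> * f \<noteq> 0" if f: "f \<in> idems" "f \<noteq> 0" "f \<preceq> e" for f
  proof -
    obtain \<xi> where \<xi>: "\<xi> \<in> ultrafilters" "f \<in> \<xi>"
      using ex_ultrafilter[OF f(1,2)] by blast
    have F: "\<xi> \<in> filters"
      using \<xi> ultrafilters_subset_filters by blast
    have "\<xi> \<in> D_set e"
      using \<xi> filters_up[OF F \<xi>(2)] f(3) a ultrafilters_subset_tight by (auto simp: D_set_def)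
    then have "theta s \<xi> = \<xi>"
      using a by blast
    moreover have "s * f * s\<^sup>\<star> \<in> theta s \<xi>"
      using \<xi>(2) conj_idem[OF f(1), of s] nat_le_idem_iff[of "s * f * s\<^sup>\<star>" "s * f * s\<^sup>\<star>"]
      by (auto simp: theta_def idems_def)
    ultimately show ?thesis
      using filters_mult[OF F _ \<xi>(2)] filters_nonzero[OF F] by metis
  qed
  then show "e \<in> W_set s"
    using a by (auto simp: W_set_def weakly_fixed_def)
qed

section \<open>The interior of the isotropy\<close>

lemma openin_Theta:
  assumes "U \<subseteq> D_set (s\<^sup>\<star> * s)" "openin tight_topology U" "compactin tight_topology U"
  shows "openin tight_groupoid_topology (Theta s U)"
  unfolding tight_groupoid_topology_def using assms by (intro topology_generated_by_Basis) blast

lemma topspace_tight_groupoid_topology: "topspace tight_groupoid_topology = tight_groupoid"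
proof (intro equalityI subsetI)
  fix \<gamma> :: "'a germ" assume "\<gamma> \<in> topspace tight_groupoid_topology"
  then show "\<gamma> \<in> tight_groupoid"
    unfolding tight_groupoid_topology_def topology_generated_by_topspace tight_groupoid_eq Theta_def
    by blast
next
  fix \<gamma> :: "'a germ" assume "\<gamma> \<in> tight_groupoid"
  then obtain s \<xi> where g: "\<gamma> = germ s \<xi>" "\<xi> \<in> D_set (s\<^sup>\<star> * s)"
    by (auto simp: tight_groupoid_eq)
  have "openin tight_groupoid_topology (Theta s (D_set (s\<^sup>\<star> * s)))"
    by (intro openin_Theta subset_refl openin_D_set compactin_D_set sinv_mult_idems)
  then show "\<gamma> \<in> topspace tight_groupoid_topology"
    using g openin_subset unfolding Theta_def by blast
qed

lemma D_set_subset_tight: "D_set e \<subseteq> tight_filters"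
  by (auto simp: D_set_def)

text \<open>This transfers open and closed sets of germs to sets of tight filters. It is enough to
  treat the generating sets \<open>Theta t U\<close>.\<close>

lemma continuous_map_germ:
  "continuous_map (subtopology tight_topology (D_set (s\<^sup>\<star> * s))) tight_groupoid_topology (germ s)"
proof -
  let ?D = "D_set (s\<^sup>\<star> * s)"
  have top: "topspace (subtopology tight_topology ?D) = ?D"
    using D_set_subset_tight by (auto simp: topspace_tight_topology)
  show ?thesis
    unfolding tight_groupoid_topology_def
  proof (rule continuous_on_generated_topo)
    fix W assume "W \<in> {Theta s U | s U. U \<subseteq> D_set (s\<^sup>\<star> * s) \<and> openin tight_topology U \<and>
      compactin tight_topology (U :: 'a set set)}"
    then obtain t U where W: "W = Theta t U" "U \<subseteq> D_set (t\<^sup>\<star> * t)" "openin tight_topology U"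
      by blast
    \<comment> \<open>The filters at which \<open>s\<close> and \<open>t\<close> have the same germ:
      agreement is witnessed by some \<open>e\<close> and persists on all of
      \<open>D_set e\<close>.\<close>
    define O' where "O' = \<Union>{D_set e | e. e \<in> idems \<and> s * e = t * e}"
    have "openin tight_topology O'"
      unfolding O'_def by (rule openin_Union) (auto intro: openin_D_set)
    moreover have "germ s -` W \<inter> ?D = (U \<inter> O') \<inter> ?D"
    proof (intro equalityI subsetI)
      fix \<xi> assume a: "\<xi> \<in> germ s -` W \<inter> ?D"
      then obtain \<eta> where \<eta>: "germ s \<xi> = germ t \<eta>" "\<eta> \<in> U"
        by (auto simp: W Theta_def)
      then obtain e where e: "\<xi> = \<eta>" "e \<in> \<xi>" "s * e = t * e"
        using germ_eq_iff[of \<xi> s \<eta> t] a W by blast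
      then have "\<xi> \<in> D_set e" "e \<in> idems"
        using a filters_idems tight_filters_subset by (auto simp: D_set_def)
      then show "\<xi> \<in> (U \<inter> O') \<inter> ?D"
        using \<eta> e a unfolding O'_def by blast
    next
      fix \<xi> assume a: "\<xi> \<in> (U \<inter> O') \<inter> ?D"
      then have "germ s \<xi> = germ t \<xi>"
        using W by (subst germ_eq_iff) (auto simp: O'_def D_set_def)
      then show "\<xi> \<in> germ s -` W \<inter> ?D"
        using a by (auto simp: W Theta_def)
    qed
    ultimately show "openin (subtopology tight_topology ?D)
        (germ s -` W \<inter> topspace (subtopology tight_topology ?D))"
      unfolding top using W(3) by (auto simp: openin_subtopology)
  next
    have "germ s ` ?D \<subseteq> topspace tight_groupoid_topology"
      by (auto simp: topspace_tight_groupoid_topology tight_groupoid_eq)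
    then show "germ s ` topspace (subtopology tight_topology ?D) \<subseteq>
      \<Union>{Theta s U | s U. U \<subseteq> D_set (s\<^sup>\<star> * s) \<and> openin tight_topology U \<and>
        compactin tight_topology (U :: 'a set set)}"
      unfolding top tight_groupoid_topology_def topology_generated_by_topspace .
  qed
qed

lemma germ_in_Iso_iff:
  "\<xi> \<in> D_set (s\<^sup>\<star> * s) \<Longrightarrow> germ s \<xi> \<in> Iso \<longleftrightarrow> theta s \<xi> = \<xi>"
  by (auto simp: Iso_def germ_dom_germ germ_ran_germ tight_groupoid_eq)

lemma openin_germ_Iso_interior:
  "openin tight_topology {\<xi> \<in> D_set (s\<^sup>\<star> * s). germ s \<xi> \<in> Iso_interior}"
proof -
  have "openin tight_groupoid_topology (Iso_interior :: 'a germ set)"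
    by (simp add: Iso_interior_def)
  then have "openin (subtopology tight_topology (D_set (s\<^sup>\<star> * s)))
    {\<xi> \<in> topspace (subtopology tight_topology (D_set (s\<^sup>\<star> * s))). germ s \<xi> \<in> Iso_interior}"
    by (rule openin_continuous_map_preimage[OF continuous_map_germ])
  moreover have "topspace (subtopology tight_topology (D_set (s\<^sup>\<star> * s))) = D_set (s\<^sup>\<star> * s)"
    using D_set_subset_tight by (auto simp: topspace_tight_topology)
  ultimately show ?thesis
    using openin_trans_full openin_D_set(1)[OF sinv_mult_idems] by metis
qed

text \<open>Near \<open>\<eta>\<close> all germs of \<open>s\<close> are isotropic, and for an
  ultrafilter the neighbourhood can be taken as \<open>D_set e\<close>; \<open>W_set_iff\<close>
  then gives weak fixedness. The set \<open>V\<close> allows further open conditions to be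
  imposed.\<close>

lemma ultrafilter_Iso_interior:
  assumes "\<eta> \<in> ultrafilters" "\<eta> \<in> D_set (s\<^sup>\<star> * s)" "germ s \<eta> \<in> Iso_interior"
    and "openin tight_topology V" "\<eta> \<in> V"
  shows "\<exists>e\<in>\<eta>. e \<in> W_set s \<and> D_set e \<subseteq> V"
proof -
  let ?U = "{\<xi> \<in> D_set (s\<^sup>\<star> * s). germ s \<xi> \<in> Iso_interior}"
  have F: "\<eta> \<in> filters"
    using assms ultrafilters_subset_filters by blast
  obtain e where e: "e \<in> \<eta>" "D_set e \<subseteq> ?U \<inter> V"
    using ultrafilter_neighbourhood[OF openin_Int[OF openin_germ_Iso_interior assms(4)] assms(1)]
      assms by blast
  \<comment> \<open>Cutting down by \<open>s\<^sup>\<star> * s\<close> ensures the order condition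
    in the definition of \<open>weakly_fixed\<close>.\<close>
  define f where "f = e * (s\<^sup>\<star> * s)"
  have I: "e \<in> idems" "s\<^sup>\<star> * s \<in> \<eta>"
    using filters_idems[OF F e(1)] assms(2) by (auto simp: D_set_def)
  have f: "f \<in> \<eta>" "f \<in> idems" "f \<preceq> e" "f \<preceq> s\<^sup>\<star> * s"
    using filters_mult[OF F e(1) I(2)] filters_idems[OF F] idem_mult_nat_le[OF I(1) sinv_mult_idems]
    by (auto simp: f_def)
  have D: "D_set f \<subseteq> ?U \<inter> V"
    using D_set_mono[OF f(3) I(1)] e(2) by blast
  then have "theta s \<xi> = \<xi>" if "\<xi> \<in> D_set f" for \<xi>
    using that germ_in_Iso_iff[of \<xi> s] interior_of_subset[of tight_groupoid_topology Iso]
    unfolding Iso_interior_def by blast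
  then show ?thesis
    using f D W_set_iff[of f s] by blast
qed

text \<open>The restriction \<open>s * e\<close> represents the same germ and belongs to
  \<open>S_Iso\<close>.\<close>

lemma germ_in_tight_groupoid_S_Iso:
  assumes e: "e \<in> W_set s" and \<xi>: "\<xi> \<in> D_set e"
  shows "germ s \<xi> \<in> tight_groupoid_S_Iso"
proof -
  have I: "e \<in> idems" "e \<preceq> s\<^sup>\<star> * s"
    using e by (auto simp: W_set_iff)
  have se: "(s * e)\<^sup>\<star> * (s * e) = e"
    by (rule sinv_mult_idem_self[OF I])
  have ee: "e * e = e"
    using I by (simp add: idems_def)
  \<comment> \<open>Below \<open>e\<close>, conjugation by \<open>s * e\<close> and by
    \<open>s\<close> coincide, so weak fixedness passes to the restriction.\<close>
  have "s * e * f * (s * e)\<^sup>\<star> * f = s * f * s\<^sup>\<star> * f" if "f \<in> idems" "f \<preceq> e" for f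
  proof -
    have f: "e * f = f" "f * e = f"
      using that I nat_le_idem_iff idems_commute by metis+
    have "s * e * f * (s * e)\<^sup>\<star> * f = s * (e * f * e) * s\<^sup>\<star> * f"
      by (simp add: sinv_mult_idem[OF I(1)] mult.assoc)
    then show ?thesis
      by (simp add: f)
  qed
  then have "s * e \<in> S_Iso"
    using e I ee unfolding S_Iso_def se
    by (auto simp: W_set_def weakly_fixed_def se nat_le_idem_iff)
  moreover have "germ s \<xi> = germ (s * e) \<xi>"
  proof (subst germ_eq_iff)
    show "\<xi> \<in> D_set (s\<^sup>\<star> * s)"
      using D_set_mono[OF I(2) sinv_mult_idems] \<xi> by blast
    show "\<xi> \<in> D_set ((s * e)\<^sup>\<star> * (s * e))"
      using \<xi> se by simp
    show "\<xi> = \<xi> \<and> (\<exists>a\<in>\<xi>. s * a = s * e * a)"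
      using \<xi> ee by (auto simp: D_set_def mult.assoc intro!: bexI[of _ e])
  qed
  ultimately show ?thesis
    using \<xi> se unfolding tight_groupoid_S_Iso_def by force
qed

text \<open>For \<open>s \<in> S_Iso\<close> the whole basic open set of germs of \<open>s\<close>
  is isotropic.\<close>

lemma tight_groupoid_S_Iso_subset: "tight_groupoid_S_Iso \<subseteq> Iso_interior"
proof
  fix \<gamma> :: "'a germ" assume "\<gamma> \<in> tight_groupoid_S_Iso"
  then obtain s \<xi> where g: "\<gamma> = germ s \<xi>" "s \<in> S_Iso" "\<xi> \<in> D_set (s\<^sup>\<star> * s)"
    by (auto simp: tight_groupoid_S_Iso_def)
  then have "s\<^sup>\<star> * s \<in> W_set s"
    by (simp add: S_Iso_def W_set_def)
  then have "Theta s (D_set (s\<^sup>\<star> * s)) \<subseteq> Iso"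
    using germ_in_Iso_iff by (auto simp: W_set_iff Theta_def)
  moreover have "openin tight_groupoid_topology (Theta s (D_set (s\<^sup>\<star> * s)))"
    by (intro openin_Theta subset_refl openin_D_set compactin_D_set sinv_mult_idems)
  ultimately have "Theta s (D_set (s\<^sup>\<star> * s)) \<subseteq> Iso_interior"
    unfolding Iso_interior_def by (rule interior_of_maximal)
  then show "\<gamma> \<in> Iso_interior"
    using g by (auto simp: Theta_def)
qed

text \<open>Avoiding the finite set \<open>C\<close> is an open condition, so a counterexample
  yields an ultrafilter counterexample. The latter contains a weakly fixed \<open>e\<close> all of
  whose tight filters avoid \<open>C\<close>, which contradicts that some \<open>c \<in> C\<close>
  meets \<open>e\<close>.\<close>

lemma finite_cover_meets_Iso_interior:
  assumes C: "finite C" "is_cover C (W_set s)"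
    and \<xi>: "\<xi> \<in> D_set (s\<^sup>\<star> * s)" "germ s \<xi> \<in> Iso_interior"
  shows "\<exists>c\<in>C. c \<in> \<xi>"
proof (rule ccontr)
  assume n: "\<not> (\<exists>c\<in>C. c \<in> \<xi>)"
  have CW: "C \<subseteq> W_set s"
    using C by (simp add: is_cover_def)
  let ?V = "{\<eta> \<in> D_set (s\<^sup>\<star> * s). germ s \<eta> \<in> Iso_interior} \<inter> (\<Inter>c\<in>C. tight_filters - D_set c)"
  \<comment> \<open>For empty \<open>C\<close> the intersection is \<open>UNIV\<close>, not the
    space of tight filters, and the rule for intersections of open sets needs a nonempty
    family.\<close>
  have V: "openin tight_topology ?V"
  proof (cases "C = {}")
    case True
    then show ?thesis
      using openin_germ_Iso_interior by simp
  next
    case False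
    then show ?thesis
      using C(1) CW by (intro openin_Int openin_germ_Iso_interior openin_INT2 openin_D_set)
        (auto simp: W_set_iff)
  qed
  have "\<xi> \<in> ?V"
    using n \<xi> by (auto simp: D_set_def)
  then have "\<exists>\<eta>\<in>ultrafilters. \<eta> \<in> ?V"
    by (rule tight_open_dense[OF V])
  then obtain \<eta> where \<eta>: "\<eta> \<in> ultrafilters" "\<eta> \<in> ?V"
    by (elim bexE)
  have \<eta>': "\<eta> \<in> D_set (s\<^sup>\<star> * s)" "germ s \<eta> \<in> Iso_interior"
    using \<eta>(2) by simp_all
  obtain e where e: "e \<in> \<eta>" "e \<in> W_set s" "D_set e \<subseteq> ?V"
    using ultrafilter_Iso_interior[OF \<eta>(1) \<eta>' V \<eta>(2)] by (elim bexE conjE)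
  have "e \<noteq> 0"
    using e(1) filters_nonzero[OF ultrafilters_subset_filters[OF \<eta>(1)]] by metis
  then obtain c where c: "c \<in> C" "e * c \<noteq> 0"
    using C(2) e(2) by (auto simp: is_cover_def)
  have I: "e \<in> idems" "c \<in> idems"
    using e(2) c(1) CW by (auto simp: W_set_iff)
  \<comment> \<open>Such a \<open>\<zeta>\<close> contains \<open>c\<close>, yet lies in
    \<open>D_set e\<close> and so should avoid it.\<close>
  obtain \<zeta> where \<zeta>: "\<zeta> \<in> ultrafilters" "e * c \<in> \<zeta>"
    using ex_ultrafilter[OF idems_mult[OF I] c(2)] by blast
  have "\<zeta> \<in> D_set (e * c)"
    using \<zeta> ultrafilters_subset_tight by (auto simp: D_set_def)
  then have "\<zeta> \<in> D_set e" "\<zeta> \<in> D_set c"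
    using D_set_mono[OF idem_mult_nat_le(1)[OF I] I(1)] D_set_mono[OF idem_mult_nat_le(2)[OF I] I(2)]
    by (simp_all add: subset_iff)
  then show False
    using e(3) c(1) by blast
qed

section \<open>The four implications\<close>

lemma Iso_interior_cases:
  assumes "\<gamma> \<in> Iso_interior"
  obtains s \<xi> where "\<gamma> = germ s \<xi>" "\<xi> \<in> D_set (s\<^sup>\<star> * s)"
  using assms interior_of_subset[of tight_groupoid_topology Iso]
  unfolding Iso_interior_def Iso_def tight_groupoid_eq by blast

text \<open>The cover places a weakly fixed \<open>c\<close> in \<open>\<xi>\<close>, and
  restricting \<open>s\<close> to \<open>c\<close> represents the germ inside
  \<open>S_Iso\<close>.\<close>

lemma Iso_interior_eq_if_covers:
  assumes "\<forall>s::'a::inverse_semigroup_zero. has_finite_cover (W_set s)"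
  shows "(Iso_interior :: 'a germ set) = tight_groupoid_S_Iso"
proof (rule equalityI[OF subsetI tight_groupoid_S_Iso_subset])
  fix \<gamma> :: "'a germ" assume \<gamma>: "\<gamma> \<in> Iso_interior"
  then obtain s \<xi> where g: "\<gamma> = germ s \<xi>" "\<xi> \<in> D_set (s\<^sup>\<star> * s)"
    by (rule Iso_interior_cases)
  obtain C where C: "finite C" "is_cover C (W_set s)"
    using assms by (auto simp: has_finite_cover_def)
  obtain c where "c \<in> C" "c \<in> \<xi>"
    using finite_cover_meets_Iso_interior[OF C g(2)] \<gamma> g(1) by blast
  then have "c \<in> W_set s" "\<xi> \<in> D_set c"
    using C g by (auto simp: is_cover_def D_set_def)
  then show "\<gamma> \<in> tight_groupoid_S_Iso"
    using g germ_in_tight_groupoid_S_Iso by blast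
qed

text \<open>Here \<open>\<xi>\<close> is itself an ultrafilter, so
  \<open>ultrafilter_Iso_interior\<close> supplies the weakly fixed idempotent directly.\<close>

lemma Iso_interior_eq_if_ultra:
  assumes "(tight_filters :: 'a::inverse_semigroup_zero set set) \<subseteq> ultrafilters"
  shows "(Iso_interior :: 'a germ set) = tight_groupoid_S_Iso"
proof (rule equalityI[OF subsetI tight_groupoid_S_Iso_subset])
  fix \<gamma> :: "'a germ" assume \<gamma>: "\<gamma> \<in> Iso_interior"
  then obtain s \<xi> where g: "\<gamma> = germ s \<xi>" "\<xi> \<in> D_set (s\<^sup>\<star> * s)"
    by (rule Iso_interior_cases)
  then obtain e where "e \<in> \<xi>" "e \<in> W_set s"
    using ultrafilter_Iso_interior[of \<xi> s "D_set (s\<^sup>\<star> * s)"] \<gamma> assms D_set_subset_tight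
      openin_D_set(1)[OF sinv_mult_idems] by blast
  then show "\<gamma> \<in> tight_groupoid_S_Iso"
    using g germ_in_tight_groupoid_S_Iso[of e s \<xi>] by (auto simp: D_set_def)
qed

lemma closedin_Iso_interior_if_covers:
  assumes "\<forall>s::'a::inverse_semigroup_zero. has_finite_cover (W_set s)"
  shows "closedin tight_groupoid_topology (Iso_interior :: 'a germ set)"
proof -
  let ?T = "tight_groupoid_topology :: 'a germ topology"
  have "\<exists>W. openin ?T W \<and> \<gamma> \<in> W \<and> W \<subseteq> topspace ?T - Iso_interior"
    if "\<gamma> \<in> topspace ?T - Iso_interior" for \<gamma> :: "'a germ"
  proof -
    obtain s \<xi> where g: "\<gamma> = germ s \<xi>" "\<xi> \<in> D_set (s\<^sup>\<star> * s)"
      using \<open>\<gamma> \<in> topspace ?T - Iso_interior\<close>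
      by (auto simp: topspace_tight_groupoid_topology tight_groupoid_eq)
    obtain C where C: "finite C" "is_cover C (W_set s)"
      using assms by (auto simp: has_finite_cover_def)
    have CI: "c \<in> idems" if "c \<in> C" for c
      using C that by (auto simp: is_cover_def W_set_iff)
    define V where "V = D_set (s\<^sup>\<star> * s) - (\<Union>c\<in>C. D_set c)"
    have clopen: "closedin tight_topology (D_set e)" if "e \<in> idems" for e :: 'a
      using openin_D_set(2)[OF that] D_set_subset_tight
      by (auto simp: closedin_def topspace_tight_topology)
    \<comment> \<open>Finiteness of \<open>C\<close> makes \<open>V\<close> clopen, hence compact
      inside \<open>D_set (s\<^sup>\<star> * s)\<close>, as a basic open set of germs
      requires.\<close>
    have V: "openin tight_topology V" "closedin tight_topology V"
      unfolding V_def using C(1) CI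
      by (intro openin_diff closedin_diff openin_D_set clopen sinv_mult_idems
          closedin_Union openin_Union; auto intro: openin_D_set clopen)+
    have sub: "V \<subseteq> D_set (s\<^sup>\<star> * s)"
      by (auto simp: V_def)
    have "openin ?T (Theta s V)"
      using closed_compactin[OF compactin_D_set[OF sinv_mult_idems] sub V(2)]
      by (rule openin_Theta[OF sub V(1)])
    \<comment> \<open>A cover element in \<open>\<xi>\<close> would put the germ into
      \<open>tight_groupoid_S_Iso\<close>, hence into the interior.\<close>
    moreover have "\<xi> \<in> V"
    proof (rule ccontr)
      assume "\<xi> \<notin> V"
      then obtain c where "c \<in> C" "\<xi> \<in> D_set c"
        using g by (auto simp: V_def)
      then have "germ s \<xi> \<in> Iso_interior"
        using germ_in_tight_groupoid_S_Iso C(2) tight_groupoid_S_Iso_subset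
        unfolding is_cover_def by blast
      then show False
        using that g by blast
    qed
    moreover have "germ s \<eta> \<notin> Iso_interior" if \<eta>: "\<eta> \<in> V" for \<eta>
    proof
      assume "germ s \<eta> \<in> Iso_interior"
      then obtain c where "c \<in> C" "c \<in> \<eta>"
        using finite_cover_meets_Iso_interior[OF C, of \<eta>] \<eta> sub by blast
      then show False
        using \<eta> by (auto simp: V_def D_set_def)
    qed
    ultimately show ?thesis
      using g openin_subset[of ?T "Theta s V"] unfolding Theta_def
      by (intro exI[of _ "germ s ` V"]) blast
  qed
  then have "openin ?T (topspace ?T - Iso_interior)"
    by (subst openin_subopen) blast
  moreover have "Iso_interior \<subseteq> topspace ?T"
    by (simp add: Iso_interior_def interior_of_subset_topspace)
  ultimately show ?thesis
    by (simp add: closedin_def)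
qed

lemma has_finite_cover_W_set_if_closed:
  fixes s :: "'a::inverse_semigroup_zero"
  assumes ultra: "(tight_filters :: 'a set set) \<subseteq> ultrafilters"
    and cl: "closedin tight_groupoid_topology (Iso_interior :: 'a germ set)"
  shows "has_finite_cover (W_set s)"
proof -
  let ?D = "D_set (s\<^sup>\<star> * s)"
  define K where "K = {\<xi> \<in> ?D. germ s \<xi> \<in> Iso_interior}"
  have top: "topspace (subtopology tight_topology ?D) = ?D"
    using D_set_subset_tight by (auto simp: topspace_tight_topology)
  have "compact_space (subtopology tight_topology ?D)"
    using compactin_D_set[OF sinv_mult_idems] by (rule compact_space_subtopology)
  moreover have "closedin (subtopology tight_topology ?D) K"
    using closedin_continuous_map_preimage[OF continuous_map_germ cl, of s]
    unfolding top K_def .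
  ultimately have "compactin (subtopology tight_topology ?D) K"
    by (rule closedin_compact_space)
  then have "compactin tight_topology K"
    by (simp add: compactin_subtopology)
  \<comment> \<open>This is where all tight filters being ultrafilters enters.\<close>
  moreover have "K \<subseteq> \<Union>(D_set ` W_set s)"
  proof
    fix \<xi> assume \<xi>: "\<xi> \<in> K"
    then obtain e where "e \<in> \<xi>" "e \<in> W_set s"
      using ultrafilter_Iso_interior[of \<xi> s ?D] ultra D_set_subset_tight
        openin_D_set(1)[OF sinv_mult_idems] unfolding K_def by blast
    then show "\<xi> \<in> \<Union>(D_set ` W_set s)"
      using \<xi> by (auto simp: K_def D_set_def)
  qed
  moreover have "openin tight_topology U" if "U \<in> D_set ` W_set s" for U
    using that openin_D_set(1) by (auto simp: W_set_iff)
  ultimately have "\<exists>\<F>. finite \<F> \<and> \<F> \<subseteq> D_set ` W_set s \<and> K \<subseteq> \<Union>\<F>"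
    by (intro compactinD)
  then obtain \<F> where "finite \<F>" "\<F> \<subseteq> D_set ` W_set s" "K \<subseteq> \<Union>\<F>"
    by (elim exE conjE)
  then obtain C where C: "finite C" "C \<subseteq> W_set s" "K \<subseteq> \<Union>(D_set ` C)"
    by (metis finite_subset_image)
  \<comment> \<open>An ultrafilter through \<open>d\<close> lies in \<open>K\<close>, hence contains
    some \<open>c \<in> C\<close>; two members of one filter have nonzero product.\<close>
  have "\<exists>c\<in>C. d * c \<noteq> 0" if d: "d \<in> W_set s" "d \<noteq> 0" for d
  proof -
    have I: "d \<in> idems" "d \<preceq> s\<^sup>\<star> * s"
      using d(1) by (auto simp: W_set_iff)
    obtain \<xi> where \<xi>: "\<xi> \<in> ultrafilters" "d \<in> \<xi>"
      using ex_ultrafilter[OF I(1) d(2)] by blast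
    have F: "\<xi> \<in> filters"
      using \<xi> ultrafilters_subset_filters by blast
    have D: "\<xi> \<in> D_set d"
      using \<xi> ultrafilters_subset_tight by (auto simp: D_set_def)
    then have "germ s \<xi> \<in> Iso_interior"
      using germ_in_tight_groupoid_S_Iso[OF d(1)] tight_groupoid_S_Iso_subset by blast
    then have "\<xi> \<in> K"
      using D D_set_mono[OF I(2) sinv_mult_idems] by (auto simp: K_def)
    then obtain c where "c \<in> C" "c \<in> \<xi>"
      using C(3) by (auto simp: D_set_def)
    then show ?thesis
      using filters_mult[OF F \<xi>(2)] filters_nonzero[OF F] by metis
  qed
  then show ?thesis
    using C unfolding has_finite_cover_def is_cover_def by blast
qed

theorem lemma3p5:
  assumes "\<forall>s::'a::inverse_semigroup_zero. has_finite_cover (J_set s)"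
  shows
    "((\<forall>s::'a. has_finite_cover (W_set s)) \<longrightarrow>
        closedin tight_groupoid_topology (Iso_interior :: 'a germ set)) \<and>
     ((\<forall>s::'a. has_finite_cover (W_set s)) \<longrightarrow>
        (Iso_interior :: 'a germ set) = tight_groupoid_S_Iso) \<and>
     ((tight_filters :: 'a set set) \<subseteq> ultrafilters \<longrightarrow>
        (Iso_interior :: 'a germ set) = tight_groupoid_S_Iso) \<and>
     ((tight_filters :: 'a set set) \<subseteq> ultrafilters \<and>
        closedin tight_groupoid_topology (Iso_interior :: 'a germ set) \<longrightarrow>
        (\<forall>s::'a. has_finite_cover (W_set s)))"
  using closedin_Iso_interior_if_covers Iso_interior_eq_if_covers Iso_interior_eq_if_ultra
    has_finite_cover_W_set_if_closed by blast

end
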